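(* For any integer $n\ge 1$, $\gamma_f^\infty(P_n\,\Box\,P_2)=\left\lceil\frac{2n}{3}\right\rceil$.
   Context: $P_n$ is the path on $n$ vertices and $\Box$ denotes the Cartesian product of graphs. $N(v)$ is the open neighbourhood and $N[v]=N(v)\cup\{v\}$ the closed neighbourhood of $v$. A fractional dominating function of a finite simple graph $G=(V,E)$ is a function $w:V\to[0,\infty)$ with $\sum_{x\in N[v]}w(x)\ge 1$ for all $v\in V$; its total weight is $\sum_{x\in V}w(x)$. Fractional eternal domination. Fix $S$. The defender chooses a fractional dominating function $w_1$ of total weight at most $S$. In each round $i\ge 1$ the attacker, who may choose attacks adaptively, attacks a vertex $v_i\in V$, and the defender chooses amounts $m_{xy,i}\ge 0$ for all $x\in V$, $y\in N(x)$, with $\sum_{y\in N(x)}m_{xy,i}\le w_i(x)$, and sets $w_{i+1}(x)=w_i(x)-\sum_{y\in N(x)}m_{xy,i}+\sum_{y\in N(x)}m_{yx,i}$. It is required that $w_{i+1}$ be a fractional dominating function and $w_{i+1}(v_i)\ge 1$. If the defender can respond in this way to every infinite sequence of attacks, $G$ can be eternally $S$-fractionally dominated. $\gamma_f^\infty(G)$ is the infimum of all $S$ for which $G$ can be eternally $S$-fractionally dominated. *)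

theory Defs
  imports Complex_Main "Graph_Theory.Pair_Digraph"
begin

(* A finite simple graph is a pair_graph: a finite, loop-free, symmetric set of arcs,
   where the edge xy is represented by the two arcs (x, y) and (y, x). *)

definition path_graph :: "nat \<Rightarrow> nat pair_pre_digraph" where
  "path_graph n = \<lparr> pverts = {1..n},
     parcs = {(i, j). i \<in> {1..n} \<and> j \<in> {1..n} \<and> (j = Suc i \<or> i = Suc j)} \<rparr>"

definition cartesian_product ::
    "'a pair_pre_digraph \<Rightarrow> 'b pair_pre_digraph \<Rightarrow> ('a \<times> 'b) pair_pre_digraph"
    (infixl "\<box>" 70) where
  "G \<box> H = \<lparr> pverts = pverts G \<times> pverts H,
     parcs = {((u, v), (u', v')).
       (u = u' \<and> u \<in> pverts G \<and> (v, v') \<in> parcs H) \<or>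
       (v = v' \<and> v \<in> pverts H \<and> (u, u') \<in> parcs G)} \<rparr>"

lemma pair_graph_path_graph: "pair_graph (path_graph n)"
proof
  show "finite (parcs (path_graph n))"
    by (rule finite_subset[of _ "{1..n} \<times> {1..n}"]) (auto simp: path_graph_def)
qed (auto simp: path_graph_def symmetric_def sym_def)

lemma pair_graph_cartesian_product:
  assumes "pair_graph G" and "pair_graph H"
  shows "pair_graph (G \<box> H)"
proof -
  interpret G: pair_graph G by fact
  interpret H: pair_graph H by fact
  have sG: "(u, v) \<in> parcs G \<Longrightarrow> (v, u) \<in> parcs G" for u v
    using G.pair_sym_arcs by (auto simp: symmetric_def dest: symD)
  have sH: "(u, v) \<in> parcs H \<Longrightarrow> (v, u) \<in> parcs H" for u v
    using H.pair_sym_arcs by (auto simp: symmetric_def dest: symD)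
  have "finite ((pverts G \<times> pverts H) \<times> (pverts G \<times> pverts H))"
    using G.pair_finite_verts H.pair_finite_verts by blast
  moreover have "parcs (G \<box> H) \<subseteq> (pverts G \<times> pverts H) \<times> (pverts G \<times> pverts H)"
    by (auto simp: cartesian_product_def dest: G.wellformed' H.wellformed')
  ultimately have fin: "finite (parcs (G \<box> H))"
    by (rule rev_finite_subset)
  show ?thesis
  proof
    show "finite (pverts (G \<box> H))"
      using G.pair_finite_verts H.pair_finite_verts by (simp add: cartesian_product_def)
    show "symmetric (with_proj (G \<box> H))"
      using sG sH by (auto simp: cartesian_product_def symmetric_def sym_def)
  qed (use fin in \<open>auto simp: cartesian_product_def
        dest: G.wellformed' H.wellformed' G.pair_no_loops H.pair_no_loops\<close>)
qed

definition open_nbhd :: "'a pair_pre_digraph \<Rightarrow> 'a \<Rightarrow> 'a set" where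
  "open_nbhd G v = {u. (v, u) \<in> parcs G}"

definition closed_nbhd :: "'a pair_pre_digraph \<Rightarrow> 'a \<Rightarrow> 'a set" where
  "closed_nbhd G v = open_nbhd G v \<union> {v}"

(* Weightings are total functions; only their values on pverts G matter. *)
definition frac_dominating :: "'a pair_pre_digraph \<Rightarrow> ('a \<Rightarrow> real) \<Rightarrow> bool" where
  "frac_dominating G w \<longleftrightarrow>
     (\<forall>x \<in> pverts G. w x \<ge> 0) \<and> (\<forall>v \<in> pverts G. (\<Sum>x \<in> closed_nbhd G v. w x) \<ge> 1)"

definition total_weight :: "'a pair_pre_digraph \<Rightarrow> ('a \<Rightarrow> real) \<Rightarrow> real" where
  "total_weight G w = (\<Sum>x \<in> pverts G. w x)"

(* m x y is the amount moved from x to its neighbour y. *)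
definition legal_move ::
    "'a pair_pre_digraph \<Rightarrow> ('a \<Rightarrow> real) \<Rightarrow> ('a \<Rightarrow> 'a \<Rightarrow> real) \<Rightarrow> bool" where
  "legal_move G w m \<longleftrightarrow>
     (\<forall>x \<in> pverts G. (\<forall>y \<in> open_nbhd G x. m x y \<ge> 0) \<and> (\<Sum>y \<in> open_nbhd G x. m x y) \<le> w x)"

definition apply_move ::
    "'a pair_pre_digraph \<Rightarrow> ('a \<Rightarrow> real) \<Rightarrow> ('a \<Rightarrow> 'a \<Rightarrow> real) \<Rightarrow> 'a \<Rightarrow> real" where
  "apply_move G w m x =
     w x - (\<Sum>y \<in> open_nbhd G x. m x y) + (\<Sum>y \<in> open_nbhd G x. m y x)"

(* A defender strategy maps the nonempty list of attacks made so far, the current one last,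
   to the move made in response. It sees no future attack; since it is deterministic, an
   adaptive attacker is the same as an arbitrary sequence of attacks. *)
type_synonym 'a strategy = "'a list \<Rightarrow> 'a \<Rightarrow> 'a \<Rightarrow> real"

(* Rounds are counted from 0: the attack v i is made against play G w1 \<sigma> v i, and the
   response leads to play G w1 \<sigma> v (Suc i). *)
primrec play ::
    "'a pair_pre_digraph \<Rightarrow> ('a \<Rightarrow> real) \<Rightarrow> 'a strategy \<Rightarrow> (nat \<Rightarrow> 'a) \<Rightarrow> nat \<Rightarrow> 'a \<Rightarrow> real" where
  "play G w1 \<sigma> v 0 = w1"
| "play G w1 \<sigma> v (Suc i) = apply_move G (play G w1 \<sigma> v i) (\<sigma> (map v [0..<Suc i]))"

definition eternally_frac_dominated :: "'a pair_pre_digraph \<Rightarrow> real \<Rightarrow> bool" where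
  "eternally_frac_dominated G S \<longleftrightarrow>
     (\<exists>w1 \<sigma>. frac_dominating G w1 \<and> total_weight G w1 \<le> S \<and>
       (\<forall>v. (\<forall>i. v i \<in> pverts G) \<longrightarrow>
         (\<forall>i. legal_move G (play G w1 \<sigma> v i) (\<sigma> (map v [0..<Suc i])) \<and>
              frac_dominating G (play G w1 \<sigma> v (Suc i)) \<and>
              play G w1 \<sigma> v (Suc i) (v i) \<ge> 1)))"

definition frac_eternal_dom_number :: "'a pair_pre_digraph \<Rightarrow> real" where
  "frac_eternal_dom_number G = Inf {S. eternally_frac_dominated G S}"

(* The infimum is over a nonempty set that is bounded below, so it is a genuine one. *)
lemma eternally_frac_dominated_order:
  assumes "pair_graph G"
  shows "eternally_frac_dominated G (real (card (pverts G)))"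
proof -
  interpret pair_graph G by fact
  have fin: "finite (closed_nbhd G v)" for v
  proof -
    have "open_nbhd G v \<subseteq> pverts G"
      by (auto simp: open_nbhd_def dest: wellformed')
    then show ?thesis
      using pair_finite_verts by (auto simp: closed_nbhd_def dest: finite_subset)
  qed
  have dom: "frac_dominating G (\<lambda>_. 1)"
  proof -
    have "card (closed_nbhd G v) \<ge> 1" for v
      using card_mono[OF fin, of "{v}" v] by (simp add: closed_nbhd_def)
    then have "real (card (closed_nbhd G v)) \<ge> 1" for v
      by (metis of_nat_1 of_nat_le_iff)
    then show ?thesis
      unfolding frac_dominating_def by simp
  qed
  have play: "play G (\<lambda>_. 1) (\<lambda>_ _ _. 0) v i = (\<lambda>_. 1)" for v i
    by (induction i) (auto simp: apply_move_def)
  show ?thesis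
    unfolding eternally_frac_dominated_def
    by (intro exI[of _ "\<lambda>_. 1"] exI[of _ "\<lambda>_ _ _. 0"])
      (simp add: dom play legal_move_def total_weight_def del: play.simps)
qed

lemma bdd_below_eternally_frac_dominated: "bdd_below {S. eternally_frac_dominated G S}"
proof (rule bdd_belowI[of _ 0])
  fix S assume "S \<in> {S. eternally_frac_dominated G S}"
  then obtain w where "frac_dominating G w" "total_weight G w \<le> S"
    by (auto simp: eternally_frac_dominated_def)
  then show "0 \<le> S"
    using sum_nonneg[of "pverts G" w] by (auto simp: frac_dominating_def total_weight_def)
qed

end

theory Submission
  imports Defs "HOL-Library.Disjoint_Sets" "HOL-Library.Indicator_Function"
begin

text \<open>
  The defender needs no more than \<open>\<lceil>2n/3\<rceil>\<close> because the ladder splits into blocks of three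
  consecutive columns, possibly followed by a shorter block, and each block can be defended on
  its own by two guards of weight 1 (by one guard if it is a single column). In a full block with
  columns 1, 2, 3 and rows \<open>a\<close>, \<open>b\<close> the pairs \<open>{a1, b3}\<close>, \<open>{b1, a3}\<close> and \<open>{a2, b2}\<close>
  dominate the block, together they contain all six vertices, and any of them turns into any
  other in one move; so the defender answers an attack by moving the guards of the attacked
  block to a pair that contains the attacked vertex. That such independent local defences add up
  is \<open>eternally_frac_dominated_parts\<close>.

  For the lower bound, weight travels at most one edge per round, so the weight that a set \<open>A\<close>
  of vertices holds before a move lies within the closed neighbourhood of \<open>A\<close> after it
  (\<open>weight_stays_near\<close>). Hence an attack just outside that neighbourhood forces one
  additional unit of weight. A single attack sequence, not even adaptive, exploits this:
  \<open>a2, a4, b5, b7, a8, a10, b11, b13, \<dots>\<close>, which sweeps three columns to the right in every two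
  rounds. The attack on column 2 forces weight 2 into the first two columns. Suppose that the
  first \<open>m\<close> columns hold \<open>2k\<close> just after an attack in column \<open>m\<close>. After the attack on
  \<open>a\<close> in column \<open>m + 2\<close>, the first \<open>m + 1\<close> columns still hold \<open>2k\<close>, and the attacked vertex
  adds 1. After that, the \<open>2k + 1\<close> units cannot have gone further than the first \<open>m + 2\<close> columns and
  the vertex \<open>a\<close> of column \<open>m + 3\<close>. The attack on \<open>b\<close> in column \<open>m + 3\<close>, in the
  other row, therefore adds another unit, and the first \<open>m + 3\<close> columns hold \<open>2k + 2\<close>. Every
  three columns thus cost the defender weight 2, and the sweep may stop in the middle of a step
  when the ladder ends; counting this for each residue of \<open>n\<close> modulo 3 gives exactly
  \<open>\<lceil>2n/3\<rceil>\<close> (\<open>ladder_lower_bound\<close>).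
\<close>

section \<open>Moving weight in a graph\<close>

lemma open_nbhd_sym:
  assumes "pair_graph G" "y \<in> open_nbhd G x"
  shows "x \<in> open_nbhd G y"
proof -
  interpret pair_graph G by fact
  show ?thesis
    using assms(2) pair_sym_arcs by (auto simp: open_nbhd_def symmetric_def dest: symD)
qed

lemma open_nbhd_subset:
  assumes "pair_graph G"
  shows "open_nbhd G x \<subseteq> pverts G"
proof -
  interpret pair_graph G by fact
  show ?thesis by (auto simp: open_nbhd_def dest: wellformed')
qed

lemma finite_pverts: "pair_graph G \<Longrightarrow> finite (pverts G)"
proof -
  assume "pair_graph G"
  then interpret pair_graph G .
  show ?thesis by (rule pair_finite_verts)
qed

lemma finite_open_nbhd: "pair_graph G \<Longrightarrow> finite (open_nbhd G x)"
  by (rule finite_subset[OF open_nbhd_subset finite_pverts])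

lemma not_in_open_nbhd_self:
  assumes "pair_graph G"
  shows "x \<notin> open_nbhd G x"
proof -
  interpret pair_graph G by fact
  show ?thesis using pair_no_loops[of "(x, x)"] by (auto simp: open_nbhd_def)
qed

text \<open>Double counting of the edges that meet \<open>A\<close>: the amounts received
  from \<open>A\<close>, summed over the receivers, equal the amounts sent by \<open>A\<close>.\<close>

lemma open_nbhd_swap:
  fixes m :: "'a \<Rightarrow> 'a \<Rightarrow> real"
  assumes "pair_graph G"
  shows "(\<Sum>x\<in>pverts G. \<Sum>y\<in>open_nbhd G x \<inter> A. m y x)
    = (\<Sum>y\<in>A \<inter> pverts G. \<Sum>x\<in>open_nbhd G y. m y x)"
proof -
  let ?V = "pverts G"
  note fin = finite_pverts[OF assms]
  have "(\<Sum>x\<in>?V. \<Sum>y\<in>open_nbhd G x \<inter> A. m y x)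
      = (\<Sum>x\<in>?V. \<Sum>y | y \<in> A \<inter> ?V \<and> y \<in> open_nbhd G x. m y x)"
    using open_nbhd_subset[OF assms] by (intro sum.cong) auto
  also have "\<dots> = (\<Sum>y\<in>A \<inter> ?V. \<Sum>x | x \<in> ?V \<and> y \<in> open_nbhd G x. m y x)"
    using fin by (intro sum.swap_restrict) auto
  also have "\<dots> = (\<Sum>y\<in>A \<inter> ?V. \<Sum>x\<in>open_nbhd G y. m y x)"
    using open_nbhd_subset[OF assms] open_nbhd_sym[OF assms]
    by (intro sum.cong) auto
  finally show ?thesis .
qed

lemma total_weight_apply_move:
  assumes "pair_graph G"
  shows "total_weight G (apply_move G w m) = total_weight G w"
  using open_nbhd_swap[OF assms, where A = UNIV and m = m]
  by (simp add: total_weight_def apply_move_def sum.distrib sum_subtractf)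

text \<open>Weight that starts in \<open>A\<close> either stays where it is or crosses one edge. The weight that other
  vertices of the closed neighbourhood hold or receive only adds to the right-hand side.\<close>

lemma weight_stays_near:
  assumes G: "pair_graph G" and legal: "legal_move G w m" and A: "A \<subseteq> pverts G"
  shows "sum w A \<le> sum (apply_move G w m) (\<Union>x\<in>A. closed_nbhd G x)"
proof -
  let ?V = "pverts G" and ?B = "\<Union>x\<in>A. closed_nbhd G x"
  let ?kept = "\<lambda>x. w x - (\<Sum>y\<in>open_nbhd G x. m x y)"
  have BV: "?B \<subseteq> ?V"
    using A open_nbhd_subset[OF G] by (auto simp: closed_nbhd_def)
  have finB: "finite ?B" using BV finite_pverts[OF G] by (rule finite_subset)
  have m0: "m x y \<ge> 0" if "y \<in> open_nbhd G x" "x \<in> ?V" for x y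
    using legal that by (auto simp: legal_move_def)
  have "sum w A = sum ?kept A + (\<Sum>y\<in>A. \<Sum>x\<in>open_nbhd G y. m y x)"
    by (simp add: sum_subtractf)
  also have "(\<Sum>y\<in>A. \<Sum>x\<in>open_nbhd G y. m y x) = (\<Sum>x\<in>?V. \<Sum>y\<in>open_nbhd G x \<inter> A. m y x)"
    using open_nbhd_swap[OF G, where A = A and m = m] A by (simp add: Int_absorb2)
  also have "\<dots> = (\<Sum>x\<in>?B. \<Sum>y\<in>open_nbhd G x \<inter> A. m y x)"
  proof (rule sum.mono_neutral_right[OF finite_pverts[OF G] BV], intro ballI)
    fix x assume "x \<in> ?V - ?B"
    then have "open_nbhd G x \<inter> A = {}"
      using open_nbhd_sym[OF G] by (auto simp: closed_nbhd_def)
    then show "(\<Sum>y\<in>open_nbhd G x \<inter> A. m y x) = 0" by simp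
  qed
  also have "\<dots> \<le> (\<Sum>x\<in>?B. \<Sum>y\<in>open_nbhd G x. m y x)"
    using open_nbhd_subset[OF G] open_nbhd_sym[OF G]
    by (intro sum_mono sum_mono2 finite_open_nbhd[OF G]) (auto intro!: m0)
  also have "sum ?kept A \<le> sum ?kept ?B"
    using legal BV by (intro sum_mono2 finB) (auto simp: closed_nbhd_def legal_move_def)
  finally show ?thesis
    by (simp add: apply_move_def sum.distrib)
qed

text \<open>What a defence yields against a fixed attack sequence. The strategy itself disappears; only
  the weightings \<open>u i\<close> before the \<open>i\<close>-th attack remain, with the inequality that links consecutive
  ones.\<close>

lemma surviving_sequence:
  assumes G: "pair_graph G" and S: "eternally_frac_dominated G S"
    and v: "\<And>i. v i \<in> pverts G"
  obtains u where "\<And>i. frac_dominating G (u i)" "\<And>i. total_weight G (u i) \<le> S"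
    "\<And>i. u (Suc i) (v i) \<ge> 1"
    "\<And>i A. A \<subseteq> pverts G \<Longrightarrow> sum (u i) A \<le> sum (u (Suc i)) (\<Union>x\<in>A. closed_nbhd G x)"
proof -
  obtain w1 \<sigma> where w1: "frac_dominating G w1" "total_weight G w1 \<le> S"
    and \<sigma>: "\<And>i. legal_move G (play G w1 \<sigma> v i) (\<sigma> (map v [0..<Suc i])) \<and>
      frac_dominating G (play G w1 \<sigma> v (Suc i)) \<and> play G w1 \<sigma> v (Suc i) (v i) \<ge> 1"
    using S v unfolding eternally_frac_dominated_def by blast
  show ?thesis
  proof (rule that[of "play G w1 \<sigma> v"])
    fix i
    show "frac_dominating G (play G w1 \<sigma> v i)"
      using w1(1) \<sigma> by (cases i) (auto simp del: play.simps(2))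
    show "total_weight G (play G w1 \<sigma> v i) \<le> S"
      using w1(2) by (induction i) (auto simp: total_weight_apply_move[OF G])
    show "play G w1 \<sigma> v (Suc i) (v i) \<ge> 1"
      using \<sigma> by blast
    fix A assume "A \<subseteq> pverts G"
    then show "sum (play G w1 \<sigma> v i) A
        \<le> sum (play G w1 \<sigma> v (Suc i)) (\<Union>x\<in>A. closed_nbhd G x)"
      using weight_stays_near[OF G] \<sigma> by simp
  qed
qed

section \<open>Strategies from families of configurations\<close>

text \<open>A family of weightings that is closed under suitable responses gives a positional strategy.
  A strategy sees only the list of attacks, so it recovers the current weighting by replaying its
  own responses to the earlier ones.\<close>

lemma eternally_frac_dominatedI:
  fixes W :: "('a \<Rightarrow> real) set"
  assumes "w0 \<in> W"
    and dom: "\<And>w. w \<in> W \<Longrightarrow> frac_dominating G w"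
    and tot: "\<And>w. w \<in> W \<Longrightarrow> total_weight G w \<le> S"
    and resp: "\<And>w v. w \<in> W \<Longrightarrow> v \<in> pverts G \<Longrightarrow>
      \<exists>m. legal_move G w m \<and> apply_move G w m \<in> W \<and> apply_move G w m v \<ge> 1"
  shows "eternally_frac_dominated G S"
proof -
  obtain \<mu> where \<mu>: "\<And>w v. w \<in> W \<Longrightarrow> v \<in> pverts G \<Longrightarrow>
      legal_move G w (\<mu> w v) \<and> apply_move G w (\<mu> w v) \<in> W \<and> apply_move G w (\<mu> w v) v \<ge> 1"
    using resp by metis
  define state where "state = foldl (\<lambda>w v. apply_move G w (\<mu> w v)) w0"
  define \<sigma> where "\<sigma> vs = \<mu> (state (butlast vs)) (last vs)" for vs
  have play: "play G w0 \<sigma> v i = state (map v [0..<i])" for v :: "nat \<Rightarrow> 'a" and i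
    by (induction i) (auto simp: state_def \<sigma>_def)
  have \<sigma>_Suc: "\<sigma> (map v [0..<Suc i]) = \<mu> (play G w0 \<sigma> v i) (v i)" for v :: "nat \<Rightarrow> 'a" and i
    by (simp add: play \<sigma>_def)
  have W: "play G w0 \<sigma> v i \<in> W" if v: "\<And>i. v i \<in> pverts G" for v :: "nat \<Rightarrow> 'a" and i
  proof (induction i)
    case 0
    show ?case using assms(1) by simp
  next
    case (Suc i)
    then show ?case using \<mu>[OF Suc v] \<sigma>_Suc[of v i] by simp
  qed
  show ?thesis
    unfolding eternally_frac_dominated_def
  proof (intro exI[of _ w0] exI[of _ \<sigma>] conjI allI impI)
    show "frac_dominating G w0" "total_weight G w0 \<le> S"
      using assms(1) dom tot by auto
    fix v :: "nat \<Rightarrow> 'a" and i assume v: "\<forall>i. v i \<in> pverts G"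
    note \<mu>' = \<mu>[OF W[of v i] v[rule_format, of i]]
    show "legal_move G (play G w0 \<sigma> v i) (\<sigma> (map v [0..<Suc i]))"
      using \<mu>' v by (simp only: \<sigma>_Suc)
    show "frac_dominating G (play G w0 \<sigma> v (Suc i))"
      using W v dom by blast
    show "play G w0 \<sigma> v (Suc i) (v i) \<ge> 1"
      using \<mu>' v by (simp only: \<sigma>_Suc play.simps)
  qed
qed

text \<open>Guards are units of weight on the vertices of a set. All guards move at once, each along at
  most one edge.\<close>

definition shiftable :: "'a pair_pre_digraph \<Rightarrow> 'a set \<Rightarrow> 'a set \<Rightarrow> bool" where
  "shiftable G D E \<longleftrightarrow> (\<exists>f. bij_betw f D E \<and> (\<forall>x\<in>D. f x \<in> closed_nbhd G x))"

lemma shiftable_refl: "shiftable G D D"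
  unfolding shiftable_def by (intro exI[of _ "\<lambda>x. x"]) (auto simp: closed_nbhd_def bij_betw_def)

lemma shiftable_singleton: "y \<in> closed_nbhd G x \<Longrightarrow> shiftable G {x} {y}"
  unfolding shiftable_def by (intro exI[of _ "\<lambda>_. y"]) (auto simp: bij_betw_def)

lemma shiftable_Un:
  assumes "shiftable G D E" "shiftable G D' E'" "D \<inter> D' = {}" "E \<inter> E' = {}"
  shows "shiftable G (D \<union> D') (E \<union> E')"
proof -
  obtain f g where f: "bij_betw f D E" "\<forall>x\<in>D. f x \<in> closed_nbhd G x"
    and g: "bij_betw g D' E'" "\<forall>x\<in>D'. g x \<in> closed_nbhd G x"
    using assms by (auto simp: shiftable_def)
  let ?h = "\<lambda>x. if x \<in> D then f x else g x"
  have "bij_betw ?h D E" using f(1) by (subst bij_betw_cong[of _ _ f]) auto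
  moreover have "bij_betw ?h D' E'" using g(1) assms(3) by (subst bij_betw_cong[of _ _ g]) auto
  ultimately have "bij_betw ?h (D \<union> D') (E \<union> E')"
    using assms(4) by (rule bij_betw_combine)
  then show ?thesis
    unfolding shiftable_def using f g by (intro exI[of _ ?h]) auto
qed

lemma shiftable_pair:
  assumes "x' \<in> closed_nbhd G x" "y' \<in> closed_nbhd G y" "x \<noteq> y" "x' \<noteq> y'"
  shows "shiftable G {x, y} {x', y'}"
  using shiftable_Un[OF shiftable_singleton[OF assms(1)] shiftable_singleton[OF assms(2)]] assms(3,4)
  by (simp add: insert_commute)

text \<open>The order in which a two-element set is written is arbitrary, so the guard at \<open>x\<close> may also
  be the one that ends at \<open>y'\<close>.\<close>

lemma shiftable_pair_crossing:
  assumes "y' \<in> closed_nbhd G x" "x' \<in> closed_nbhd G y" "x \<noteq> y" "x' \<noteq> y'"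
  shows "shiftable G {x, y} {x', y'}"
  using shiftable_pair[OF assms(1,2,3)] assms(4) by (metis insert_commute)

lemma move_guards:
  assumes G: "pair_graph G" and "shiftable G D E"
  shows "\<exists>m. legal_move G (indicator D) m \<and> apply_move G (indicator D) m = indicator E"
proof -
  obtain f where bij: "bij_betw f D E" and f: "\<And>x. x \<in> D \<Longrightarrow> f x \<in> closed_nbhd G x"
    using assms(2) by (auto simp: shiftable_def)
  define m :: "'a \<Rightarrow> 'a \<Rightarrow> real" where "m x y = of_bool (x \<in> D \<and> y = f x)" for x y
  (* If f fixes x, then m x x = 1, but x is not its own neighbour and no sum over a
     neighbourhood counts this entry. *)
  have f': "f x \<in> open_nbhd G x \<longleftrightarrow> f x \<noteq> x" if "x \<in> D" for x
    using f[OF that] not_in_open_nbhd_self[OF G, of x] by (auto simp: closed_nbhd_def)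
  have out: "(\<Sum>y\<in>open_nbhd G x. m x y) = of_bool (x \<in> D \<and> f x \<noteq> x)" for x
  proof (cases "x \<in> D")
    case True
    have "(\<Sum>y\<in>open_nbhd G x. m x y) = (\<Sum>y\<in>open_nbhd G x. if y = f x then 1 else 0)"
      using True by (intro sum.cong) (auto simp: m_def)
    then show ?thesis using True f' finite_open_nbhd[OF G] by simp
  qed (simp add: m_def)
  have inc: "(\<Sum>y\<in>open_nbhd G x. m y x) = of_bool (x \<in> E \<and> \<not> (x \<in> D \<and> f x = x))" for x
  proof (cases "x \<in> E")
    case False
    then have "m y x = 0" for y using bij by (auto simp: m_def bij_betw_def)
    then show ?thesis using False by simp
  next
    case True
    then obtain z where z: "z \<in> D" "f z = x" using bij by (auto simp: bij_betw_def)
    have uniq: "y \<in> D \<and> x = f y \<longleftrightarrow> y = z" for y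
      using z bij by (auto simp: bij_betw_def inj_on_def)
    have "(\<Sum>y\<in>open_nbhd G x. m y x) = (\<Sum>y\<in>open_nbhd G x. if y = z then 1 else 0)"
      by (intro sum.cong) (auto simp: m_def uniq)
    also have "\<dots> = of_bool (z \<in> open_nbhd G x)" using finite_open_nbhd[OF G] by simp
    also have "z \<in> open_nbhd G x \<longleftrightarrow> z \<noteq> x"
      using f'[OF z(1)] z(2) open_nbhd_sym[OF G] by metis
    also have "z \<noteq> x \<longleftrightarrow> \<not> (x \<in> D \<and> f x = x)" using uniq[of x] by auto
    finally show ?thesis using True by simp
  qed
  have E: "x \<in> E" if "x \<in> D" "f x = x" for x
    using bij_betw_apply[OF bij that(1)] that(2) by simp
  have "legal_move G (indicator D) m"
    unfolding legal_move_def out by (auto simp: m_def indicator_def)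
  moreover have "apply_move G (indicator D) m = indicator E"
    unfolding apply_move_def out inc using E by (auto simp: indicator_def fun_eq_iff)
  ultimately show ?thesis by blast
qed

lemma sum_indicator_card:
  assumes "finite A"
  shows "(\<Sum>x\<in>A. indicator B x) = real (card (A \<inter> B))"
  using assms by (simp add: indicator_def of_bool_def sum.If_cases)

text \<open>Local defences add up. The defender keeps one guard set from \<open>\<D> i\<close> in each part \<open>P i\<close> and
  answers an attack inside the attacked part alone; moves may use any edge of \<open>G\<close>, but
  the parts do not interfere since the guard sets of different parts are disjoint.\<close>

lemma eternally_frac_dominated_parts:
  fixes P :: "'i \<Rightarrow> 'a set"
  assumes G: "pair_graph G" and I: "finite I"
    and V: "pverts G = (\<Union>i\<in>I. P i)" and disj: "disjoint_family_on P I"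
    and ne: "\<And>i. i \<in> I \<Longrightarrow> \<D> i \<noteq> {}"
    and sub: "\<And>i D. i \<in> I \<Longrightarrow> D \<in> \<D> i \<Longrightarrow> D \<subseteq> P i"
    and card: "\<And>i D. i \<in> I \<Longrightarrow> D \<in> \<D> i \<Longrightarrow> card D \<le> s i"
    and dom: "\<And>i D v. i \<in> I \<Longrightarrow> D \<in> \<D> i \<Longrightarrow> v \<in> P i \<Longrightarrow> \<exists>x\<in>D. x \<in> closed_nbhd G v"
    and resp: "\<And>i D v. i \<in> I \<Longrightarrow> D \<in> \<D> i \<Longrightarrow> v \<in> P i \<Longrightarrow>
      \<exists>E\<in>\<D> i. v \<in> E \<and> shiftable G D E"
  shows "eternally_frac_dominated G (\<Sum>i\<in>I. real (s i))"
proof -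
  define W :: "('a \<Rightarrow> real) set" where
    "W = {indicator (\<Union>i\<in>I. c i) | c. \<forall>i\<in>I. c i \<in> \<D> i}"
  note finV = finite_pverts[OF G]
  have cV: "(\<Union>i\<in>I. c i) \<subseteq> pverts G" if "\<forall>i\<in>I. c i \<in> \<D> i" for c
    using that sub V by blast
  have "\<forall>i\<in>I. \<exists>D. D \<in> \<D> i" using ne by blast
  then obtain c0 where "\<forall>i\<in>I. c0 i \<in> \<D> i" by (auto dest: bchoice)
  then have "indicator (\<Union>i\<in>I. c0 i) \<in> W" by (auto simp: W_def)
  then show ?thesis
  proof (rule eternally_frac_dominatedI)
    fix w :: "'a \<Rightarrow> real" assume "w \<in> W"
    then obtain c where w: "w = indicator (\<Union>i\<in>I. c i)" and c: "\<forall>i\<in>I. c i \<in> \<D> i"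
      by (auto simp: W_def)
    have "(\<Sum>x\<in>closed_nbhd G v. w x) \<ge> 1" if v: "v \<in> pverts G" for v
    proof -
      have fin: "finite (closed_nbhd G v)"
        using finite_open_nbhd[OF G] by (simp add: closed_nbhd_def)
      obtain i where "i \<in> I" "v \<in> P i" using v unfolding V by blast
      then obtain x where "x \<in> closed_nbhd G v" "x \<in> c i" using dom c by blast
      then have "card (closed_nbhd G v \<inter> (\<Union>i\<in>I. c i)) > 0"
        using fin \<open>i \<in> I\<close> by (subst card_gt_0_iff) auto
      moreover have "(\<Sum>x\<in>closed_nbhd G v. w x) = real (card (closed_nbhd G v \<inter> (\<Union>i\<in>I. c i)))"
        using fin by (simp add: w sum_indicator_card)
      ultimately show ?thesis by linarith
    qed
    then show "frac_dominating G w"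
      by (simp add: frac_dominating_def w)
    have "total_weight G w = real (card (\<Union>i\<in>I. c i))"
      using finV cV[OF c] by (simp add: total_weight_def w sum_indicator_card Int_absorb1)
    also have "card (\<Union>i\<in>I. c i) \<le> (\<Sum>i\<in>I. card (c i))" using I by (rule card_UN_le)
    also have "\<dots> \<le> (\<Sum>i\<in>I. s i)" using card c by (intro sum_mono) auto
    finally show "total_weight G w \<le> (\<Sum>i\<in>I. real (s i))" by simp
    fix v assume "v \<in> pverts G"
    then obtain i where i: "i \<in> I" "v \<in> P i" unfolding V by blast
    then obtain E where E: "E \<in> \<D> i" "v \<in> E" "shiftable G (c i) E" using resp c by blast
    define R where "R = (\<Union>j\<in>I - {i}. c j)"
    have "P i \<inter> P j = {}" if "j \<in> I - {i}" for j
      using disj i(1) that by (auto simp: disjoint_family_on_def)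
    then have R: "P i \<inter> R = {}" using sub c by (force simp: R_def)
    have "shiftable G (c i \<union> R) (E \<union> R)"
      using R sub[OF i(1)] c i(1) E(1) by (intro shiftable_Un E(3) shiftable_refl) auto
    moreover have "c i \<union> R = (\<Union>i\<in>I. c i)" using i(1) by (auto simp: R_def)
    moreover have "E \<union> R = (\<Union>j\<in>I. (c(i := E)) j)" using i(1) by (auto simp: R_def)
    ultimately obtain m where m: "legal_move G w m"
      "apply_move G w m = indicator (\<Union>j\<in>I. (c(i := E)) j)"
      using move_guards[OF G] w by metis
    have "\<forall>j\<in>I. (c(i := E)) j \<in> \<D> j" using c E(1) by simp
    then have "indicator (\<Union>j\<in>I. (c(i := E)) j) \<in> W" unfolding W_def by blast
    moreover have "indicator (\<Union>j\<in>I. (c(i := E)) j) v = (1::real)"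
      using i(1) E(2) by (auto simp: indicator_def)
    ultimately show "\<exists>m. legal_move G w m \<and> apply_move G w m \<in> W \<and> apply_move G w m v \<ge> 1"
      using m by (intro exI[of _ m]) simp
  qed
qed

section \<open>The ladder\<close>

abbreviation ladder :: "nat \<Rightarrow> (nat \<times> nat) pair_pre_digraph" where
  "ladder n \<equiv> path_graph n \<box> path_graph 2"

lemma pair_graph_ladder: "pair_graph (ladder n)"
  by (intro pair_graph_cartesian_product pair_graph_path_graph)

lemma pverts_ladder: "pverts (ladder n) = {1..n} \<times> {1..2}"
  by (simp add: cartesian_product_def path_graph_def)

lemma mem_closed_nbhd_ladder:
  "(d, q) \<in> closed_nbhd (ladder n) (c, r) \<longleftrightarrow>
     d = c \<and> q = r \<or>
     c \<in> {1..n} \<and> d \<in> {1..n} \<and> r \<in> {1..2} \<and> q \<in> {1..2} \<and>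
       (d = c \<and> q \<noteq> r \<or> q = r \<and> (d = Suc c \<or> c = Suc d))"
  by (auto simp: closed_nbhd_def open_nbhd_def cartesian_product_def path_graph_def)

section \<open>The defender\<close>

definition block :: "nat \<Rightarrow> nat \<Rightarrow> (nat \<times> nat) set" where
  "block n j = {3 * j + 1..min (3 * j + 3) n} \<times> {1..2}"

text \<open>The last block of the ladder may consist of one or two columns. A full block has the three
  guard pairs described at the beginning; in two columns the diagonals of the 4-cycle play the
  same part, and in one column either vertex does.\<close>

definition block_guards :: "nat \<Rightarrow> nat \<Rightarrow> (nat \<times> nat) set set" where
  "block_guards n j = (let c = 3 * j in
     if n = c + 1 then {{(c + 1, 1)}, {(c + 1, 2)}}
     else if n = c + 2 then {{(c + 1, 1), (c + 2, 2)}, {(c + 1, 2), (c + 2, 1)}}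
     else {{(c + 1, 1), (c + 3, 2)}, {(c + 1, 2), (c + 3, 1)}, {(c + 2, 1), (c + 2, 2)}})"

lemma block_cases:
  fixes j n :: nat
  assumes "3 * j < n"
  obtains "n = 3 * j + 1" | "n = 3 * j + 2" | "n \<ge> 3 * j + 3"
  using assms by linarith

lemma block_guards_respond:
  assumes "3 * j < n" "D \<in> block_guards n j" "v \<in> block n j"
  shows "\<exists>E\<in>block_guards n j. v \<in> E \<and> shiftable (ladder n) D E"
proof -
  have all: "shiftable (ladder n) D E" if "E \<in> block_guards n j" for E
    using assms(1)
  proof (cases rule: block_cases)
    case 1
    then show ?thesis using assms(2) that
      by (auto simp: block_guards_def Let_def mem_closed_nbhd_ladder intro!: shiftable_singleton)
  next
    case 2
    then show ?thesis using assms(2) that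
      by (auto simp: block_guards_def Let_def mem_closed_nbhd_ladder
          intro: shiftable_refl intro!: shiftable_pair)
  next
    case 3
    (* The two diagonal pairs ?A and ?B exchange by moving both guards across their rungs. A
       diagonal pair and the middle pair ?M exchange by moving both guards along the rows;
       the vertices of ?B are listed with row 2 first, those of ?M with row 1 first. *)
    let ?c = "3 * j"
    let ?A = "{(?c + 1, 1), (?c + 3, 2)}" and ?B = "{(?c + 1, 2), (?c + 3, 1)}"
      and ?M = "{(?c + 2, 1), (?c + 2, 2)}"
    have "shiftable (ladder n) ?A ?B" "shiftable (ladder n) ?B ?A"
      "shiftable (ladder n) ?A ?M" "shiftable (ladder n) ?M ?A"
      using 3 by (intro shiftable_pair; simp add: mem_closed_nbhd_ladder)+
    moreover have "shiftable (ladder n) ?B ?M" "shiftable (ladder n) ?M ?B"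
      using 3 by (intro shiftable_pair_crossing; simp add: mem_closed_nbhd_ladder)+
    moreover have "D \<in> {?A, ?B, ?M}" "E \<in> {?A, ?B, ?M}"
      using 3 assms(2) that by (simp_all add: block_guards_def Let_def)
    ultimately show ?thesis
      using shiftable_refl[of "ladder n" D] by (elim insertE emptyE) (simp_all only:)
  qed
  moreover have "\<exists>E\<in>block_guards n j. v \<in> E"
    using assms(1)
  proof (cases rule: block_cases)
    case 1
    then show ?thesis using assms(3) by (auto simp: block_guards_def block_def Let_def le_Suc_eq)
  next
    case 2
    then show ?thesis using assms(3) 
      by (cases v) (force simp: block_guards_def block_def Let_def)
  next
    case 3
    then obtain c r where v: "v = (c, r)" "c = 3 * j + 1 \<or> c = 3 * j + 2 \<or> c = 3 * j + 3"
      "r = 1 \<or> r = 2"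
      using assms(3) by (cases v) (force simp: block_def)
    then show ?thesis using 3 by (auto simp: block_guards_def Let_def)
  qed
  ultimately show ?thesis by blast
qed

lemma block_guards_dominate:
  assumes "3 * j < n" "D \<in> block_guards n j" "v \<in> block n j"
  shows "\<exists>x\<in>D. x \<in> closed_nbhd (ladder n) v"
  using assms(1)
proof (cases rule: block_cases)
  case 1
  obtain c r where v: "v = (c, r)" "c = 3 * j + 1" "r = 1 \<or> r = 2"
    using assms(3) 1 by (cases v) (force simp: block_def)
  show ?thesis using assms(2) 1 v(2,3) unfolding v(1)
    by (auto simp: block_guards_def Let_def mem_closed_nbhd_ladder)
next
  case 2
  obtain c r where v: "v = (c, r)" "c = 3 * j + 1 \<or> c = 3 * j + 2" "r = 1 \<or> r = 2"
    using assms(3) 2 by (cases v) (force simp: block_def)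
  show ?thesis using assms(2) 2 v(2,3) unfolding v(1)
    by (auto simp: block_guards_def Let_def mem_closed_nbhd_ladder)
next
  case 3
  then obtain c r where v: "v = (c, r)" "c = 3 * j + 1 \<or> c = 3 * j + 2 \<or> c = 3 * j + 3"
    "r = 1 \<or> r = 2"
    using assms(3) by (cases v) (force simp: block_def)
  show ?thesis using assms(2) 3 v(2,3) unfolding v(1)
    by (auto simp: block_guards_def Let_def mem_closed_nbhd_ladder)
qed

lemma sum_block_sizes:
  fixes n :: nat
  shows "(\<Sum>j<(n + 2) div 3. min 2 (n - 3 * j)) = (2 * n + 2) div 3"
proof -
  have full: "(\<Sum>j<k. min 2 (n - 3 * j)) = 2 * k" if "3 * k \<le> n" for k :: nat
  proof -
    have "(\<Sum>j<k. min 2 (n - 3 * j)) = (\<Sum>j<k. 2)"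
      using that by (intro sum.cong) auto
    then show ?thesis by simp
  qed
  have "n = 3 * (n div 3) \<or> n = 3 * (n div 3) + 1 \<or> n = 3 * (n div 3) + 2" by presburger
  then obtain k where "n = 3 * k \<or> n = 3 * k + 1 \<or> n = 3 * k + 2" by blast
  then show ?thesis
  proof (elim disjE)
    assume n: "n = 3 * k"
    then have "(n + 2) div 3 = k" "(2 * n + 2) div 3 = 2 * k" by presburger+
    then show ?thesis using full[of k] n by simp
  next
    assume n: "n = 3 * k + 1"
    then have "(n + 2) div 3 = Suc k" "(2 * n + 2) div 3 = 2 * k + 1" by presburger+
    then show ?thesis using full[of k] n by simp
  next
    assume n: "n = 3 * k + 2"
    then have "(n + 2) div 3 = Suc k" "(2 * n + 2) div 3 = 2 * k + 2" by presburger+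
    then show ?thesis using full[of k] n by simp
  qed
qed

lemma ladder_defended: "eternally_frac_dominated (ladder n) (real ((2 * n + 2) div 3))"
proof -
  let ?I = "{..<(n + 2) div 3}"
  have I: "3 * j < n" if "j \<in> ?I" for j using that by auto
  have "eternally_frac_dominated (ladder n) (\<Sum>j\<in>?I. real (min 2 (n - 3 * j)))"
  proof (rule eternally_frac_dominated_parts[where P = "block n" and \<D> = "block_guards n"])
    show "pverts (ladder n) = (\<Union>j\<in>?I. block n j)"
    proof
      show "pverts (ladder n) \<subseteq> (\<Union>j\<in>?I. block n j)"
      proof
        fix v assume "v \<in> pverts (ladder n)"
        then obtain c r where "v = (c, r)" "1 \<le> c" "c \<le> n" "r \<in> {1..2}"
          by (auto simp: pverts_ladder)
        then have "v \<in> block n ((c - 1) div 3)" "(c - 1) div 3 \<in> ?I"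
          by (auto simp: block_def)
        then show "v \<in> (\<Union>j\<in>?I. block n j)" by blast
      qed
    qed (auto simp: pverts_ladder block_def)
    show "disjoint_family_on (block n) ?I"
      by (auto simp: disjoint_family_on_def block_def)
    show "D \<subseteq> block n j" if "j \<in> ?I" "D \<in> block_guards n j" for j D
      using I[OF that(1)] that(2) by (auto simp: block_def block_guards_def Let_def split: if_splits)
    show "card D \<le> min 2 (n - 3 * j)" if "j \<in> ?I" "D \<in> block_guards n j" for j D
      using I[OF that(1)] that(2) by (auto simp: block_guards_def Let_def split: if_splits)
    show "block_guards n j \<noteq> {}" for j
      by (simp add: block_guards_def Let_def)
    show "\<exists>x\<in>D. x \<in> closed_nbhd (ladder n) v"
      if "j \<in> ?I" "D \<in> block_guards n j" "v \<in> block n j" for j D v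
      by (rule block_guards_dominate[OF I[OF that(1)] that(2,3)])
    show "\<exists>E\<in>block_guards n j. v \<in> E \<and> shiftable (ladder n) D E"
      if "j \<in> ?I" "D \<in> block_guards n j" "v \<in> block n j" for j D v
      by (rule block_guards_respond[OF I[OF that(1)] that(2,3)])
  qed (simp_all add: pair_graph_ladder)
  then show ?thesis using sum_block_sizes[of n] by (simp flip: of_nat_sum)
qed

section \<open>The attacker\<close>

text \<open>The attacks visit columns 2, 4, 5, 7, 8, 10, \<open>\<dots>\<close>; the row changes with each step from
  column \<open>3k + 4\<close> to column \<open>3k + 5\<close>.\<close>

definition sweep :: "nat \<Rightarrow> nat \<times> nat" where
  "sweep i = (3 * (i div 2) + (if even i then 2 else 4), 1 + i div 2 mod 2)"

definition columns :: "nat \<Rightarrow> (nat \<times> nat) set" where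
  "columns k = {1..k} \<times> {1..2}"

lemma ladder_lower_bound:
  assumes n: "n \<ge> 1" and S: "eternally_frac_dominated (ladder n) S"
  shows "real ((2 * n + 2) div 3) \<le> S"
proof -
  let ?V = "pverts (ladder n)"
  define v where "v i = (if sweep i \<in> ?V then sweep i else (1, 1))" for i
  (* The sweep leaves the ladder eventually; the later attacks only have to be legal. *)
  have "v i \<in> ?V" for i using n by (auto simp: v_def pverts_ladder)
  then obtain u where dom: "\<And>i. frac_dominating (ladder n) (u i)"
    and tot: "\<And>i. total_weight (ladder n) (u i) \<le> S"
    and hit: "\<And>i. u (Suc i) (v i) \<ge> 1"
    and near: "\<And>i A. A \<subseteq> ?V \<Longrightarrow>
      sum (u i) A \<le> sum (u (Suc i)) (\<Union>x\<in>A. closed_nbhd (ladder n) x)"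
    using surviving_sequence[OF pair_graph_ladder S] by metis
  have fin: "finite A" if "A \<subseteq> ?V" for A
    using that finite_pverts[OF pair_graph_ladder] by (rule finite_subset)
  have mono: "sum (u i) A \<le> sum (u i) B" if "A \<subseteq> B" "B \<subseteq> ?V" for i A B
    using that dom[of i] by (intro sum_mono2 fin) (auto simp: frac_dominating_def)
  have spread: "sum (u i) A \<le> sum (u (Suc i)) B"
    if "A \<subseteq> ?V" "B \<subseteq> ?V" "\<And>x y. x \<in> A \<Longrightarrow> y \<in> closed_nbhd (ladder n) x \<Longrightarrow> y \<in> B" for i A B
  proof -
    have "sum (u i) A \<le> sum (u (Suc i)) (\<Union>x\<in>A. closed_nbhd (ladder n) x)"
      using that(1) by (rule near)
    also have "\<dots> \<le> sum (u (Suc i)) B" using that by (intro mono) auto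
    finally show ?thesis .
  qed
  have add_hit: "sum (u (Suc i)) A + 1 \<le> sum (u (Suc i)) (insert (sweep i) A)"
    if "A \<subseteq> ?V" "sweep i \<in> ?V" "sweep i \<notin> A" for i A
    using hit[of i] that fin[of A] by (simp add: v_def)
  have S_ge: "sum (u i) A \<le> S" if "A \<subseteq> ?V" for i A
    using mono[OF that order_refl, of i] tot[of i] by (simp add: total_weight_def)
  (* Column 3k+4 is one beyond the reach of the weight that the first 3k+2 columns held. *)
  have gap: "real (2 * k + 3) \<le> sum (u (2 * k + 2)) (insert (sweep (2 * k + 1)) (columns (3 * k + 3)))"
    if IH: "real (2 * k + 2) \<le> sum (u (2 * k + 1)) (columns (3 * k + 2))" and k: "3 * k + 4 \<le> n" for k
  proof -
    have "sum (u (2 * k + 1)) (columns (3 * k + 2)) \<le> sum (u (Suc (2 * k + 1))) (columns (3 * k + 3))"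
      using k by (intro spread) (auto simp: columns_def pverts_ladder mem_closed_nbhd_ladder)
    moreover have "sum (u (Suc (2 * k + 1))) (columns (3 * k + 3)) + 1
        \<le> sum (u (Suc (2 * k + 1))) (insert (sweep (2 * k + 1)) (columns (3 * k + 3)))"
      using k by (intro add_hit) (auto simp: columns_def pverts_ladder sweep_def)
    ultimately show ?thesis using IH by simp
  qed
  have main: "real (2 * k + 2) \<le> sum (u (2 * k + 1)) (columns (3 * k + 2))" if "3 * k + 2 \<le> n" for k
    using that
  proof (induction k)
    case 0
    (* The closed neighbourhood of (1, 2) misses the attacked vertex (2, 1). *)
    have cols: "columns 2 = insert (sweep 0) (closed_nbhd (ladder n) (1, 2))"
      using 0 by (auto simp: columns_def sweep_def mem_closed_nbhd_ladder)
    have "1 \<le> sum (u 1) (closed_nbhd (ladder n) (1, 2))"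
      using dom[of 1] 0 by (auto simp: frac_dominating_def pverts_ladder)
    moreover have "sum (u (Suc 0)) (closed_nbhd (ladder n) (1, 2)) + 1 \<le> sum (u (Suc 0)) (columns 2)"
      unfolding cols using 0
      by (intro add_hit) (auto simp: pverts_ladder sweep_def mem_closed_nbhd_ladder)
    ultimately show ?case by (simp del: add_2_eq_Suc')
  next
    case (Suc k)
    (* The weight counted in gap cannot leave ?B: it lies in columns 1..3k+3 except for the part
       on the attacked vertex of column 3k+4, which can reach column 3k+5 only in its own row.
       The next attack hits the other row. *)
    let ?B = "insert (3 * k + 5, 1 + k mod 2) (columns (3 * k + 4))"
    have cols: "columns (3 * k + 5) = insert (sweep (2 * k + 2)) ?B"
      by (cases "even k") (auto simp: columns_def sweep_def even_iff_mod_2_eq_zero odd_iff_mod_2_eq_one mod_Suc)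
    have "real (2 * k + 3) \<le> sum (u (2 * k + 2)) (insert (sweep (2 * k + 1)) (columns (3 * k + 3)))"
      using Suc by (intro gap) auto
    also have "\<dots> \<le> sum (u (Suc (2 * k + 2))) ?B"
      using Suc.prems
      by (intro spread) (auto simp: columns_def pverts_ladder mem_closed_nbhd_ladder sweep_def)
    also have "\<dots> + 1 \<le> sum (u (Suc (2 * k + 2))) (columns (3 * k + 5))"
      unfolding cols using Suc.prems
      by (intro add_hit) (auto simp: columns_def pverts_ladder sweep_def mod_Suc)
    finally show ?case by (simp add: eval_nat_numeral)
  qed
  have "n = 1 \<or> (\<exists>k. n = 3 * k + 2) \<or> (\<exists>k. n = 3 * k + 3) \<or> (\<exists>k. n = 3 * k + 4)"
    using n by presburger
  then consider "n = 1" | k where "n = 3 * k + 2" | k where "n = 3 * k + 3" | k where "n = 3 * k + 4"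
    by blast
  then show ?thesis
  proof cases
    case 1
    have "v 0 = (1, 1)" using 1 by (simp add: v_def sweep_def pverts_ladder)
    then show ?thesis using hit[of 0] S_ge[of "{(1, 1)}" 1] 1 by (simp add: pverts_ladder)
  next
    case (2 k)
    then have "(2 * n + 2) div 3 = 2 * k + 2" by presburger
    then show ?thesis using 2 main[of k] S_ge[of "columns (3 * k + 2)" "2 * k + 1"]
      by (simp add: columns_def pverts_ladder)
  next
    case (3 k)
    then have "(2 * n + 2) div 3 = 2 * k + 2" by presburger
    moreover have "columns (3 * k + 2) \<subseteq> ?V" using 3 by (auto simp: columns_def pverts_ladder)
    ultimately show ?thesis using 3 main[of k] S_ge[of "columns (3 * k + 2)" "2 * k + 1"]
      by simp
  next
    case (4 k)
    then have "(2 * n + 2) div 3 = 2 * k + 3" by presburger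
    moreover
    have "insert (sweep (2 * k + 1)) (columns (3 * k + 3)) \<subseteq> ?V"
      using 4 by (auto simp: columns_def pverts_ladder sweep_def)
    ultimately show ?thesis
      using gap[OF main[of k]] S_ge[of "insert (sweep (2 * k + 1)) (columns (3 * k + 3))" "2 * k + 2"] 4
      by simp
  qed
qed

lemma ceiling_two_thirds: "real_of_int \<lceil>2 * real n / 3\<rceil> = real ((2 * n + 2) div 3)"
proof -
  have "\<lceil>2 * real n / 3\<rceil> = int ((2 * n + 2) div 3)"
    by (rule ceiling_unique) linarith+
  then show ?thesis by simp
qed

theorem theorem6p2:
  fixes n :: nat
  assumes "n \<ge> 1"
  shows "frac_eternal_dom_number (path_graph n \<box> path_graph 2) = real_of_int \<lceil>2 * real n / 3\<rceil>"
  unfolding frac_eternal_dom_number_def ceiling_two_thirds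
  using ladder_defended ladder_lower_bound[OF assms] by (intro cInf_eq_minimum) auto

end
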